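(* For any $x\in\left(0,\frac{\pi}{2}\right]$ and any $t>0$ one has $$\left(\frac{x}{\sin x}\right)^{2t}+\left(\frac{x}{\sinh x}\right)^t>\left(\frac{\sinh x}{x}\right)^{2t}+\left(\frac{\sin x}{x}\right)^t>2$$ and $$2\left(\frac{x}{\sin x}\right)^t+\left(\frac{x}{\sinh x}\right)^t>2\left(\frac{\sinh x}{x}\right)^t+\left(\frac{\sin x}{x}\right)^t>3 .$$ *)

theory Defs
  imports Complex_Main
begin

end

theory Submission
  imports Defs
begin

text \<open>
  Put \<open>a = x / sin x\<close> and \<open>b = sinh x / x\<close>. The two left-hand inequalities say that
  the increasing functions \<open>u powr (2 * t) - u powr (- t)\<close> and \<open>2 * u powr t - u powr (- t)\<close>
  are larger at \<open>a\<close> than at \<open>b\<close>, so they follow from \<open>b < a\<close>. The two right-hand inequalities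
  follow from \<open>a < b\<^sup>2\<close> by the AM-GM inequality for two and three numbers.
  Both comparisons of \<open>a\<close> with \<open>b\<close> come from repeated differentiation at the origin; the fourth
  derivative of \<open>x\<^sup>2 - sin x * sinh x\<close> is \<open>4 * sin x * sinh x\<close>.
\<close>

text \<open>Mean value theorem. Positivity of \<open>f'\<close> is not demanded at 0, so the lemma
  can be iterated along successive derivatives that all vanish at the origin.\<close>

lemma pos_if_deriv_pos:
  fixes f f' :: "real \<Rightarrow> real"
  assumes "0 < x" and zero: "f 0 = 0"
    and deriv: "\<And>y. (f has_real_derivative f' y) (at y)"
    and pos: "\<And>y. 0 < y \<Longrightarrow> y \<le> x \<Longrightarrow> 0 < f' y"
  shows "0 < f x"
proof -
  obtain z where "0 < z" "z < x" "f x - f 0 = (x - 0) * f' z"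
    using MVT2[OF \<open>0 < x\<close>, of f f'] deriv by blast
  then show ?thesis
    using zero pos[of z] \<open>0 < x\<close> by simp
qed

text \<open>Start of a chain of Taylor bounds: from \<open>sin_less\<close> through the next two
  lemmas, each difference of the two sides has the preceding difference as its derivative.\<close>

lemma cos_greater_quadratic:
  fixes x :: real
  assumes "0 < x"
  shows "1 - x\<^sup>2 / 2 < cos x"
proof -
  have sin_less: "sin y < y" if "0 < y" for y :: real
  \<comment> \<open>The derivative \<open>1 - cos z\<close> vanishes again at 2 pi, so it is used
    only up to 1; beyond that, sin y <= 1 < y.\<close>
  proof (cases "y \<le> 1")
    case True
    have "cos z < 1" if "0 < z" "z \<le> 1" for z :: real
      using cos_monotone_0_pi[of 0 z] that pi_ge_two by simp
    then have "0 < y - sin y"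
      by (intro pos_if_deriv_pos[of y "\<lambda>z. z - sin z" "\<lambda>z. 1 - cos z"])
        (use \<open>0 < y\<close> True in \<open>auto intro!: derivative_eq_intros\<close>)
    then show ?thesis by simp
  next
    case False
    with sin_le_one[of y] show ?thesis by linarith
  qed
  have "0 < cos x - 1 + x\<^sup>2 / 2"
    by (rule pos_if_deriv_pos[of x "\<lambda>z. cos z - 1 + z\<^sup>2 / 2" "\<lambda>z. z - sin z"])
      (use assms sin_less in \<open>auto intro!: derivative_eq_intros\<close>)
  then show ?thesis by simp
qed

lemma sin_greater_cubic:
  fixes x :: real
  assumes "0 < x"
  shows "x - x ^ 3 / 6 < sin x"
proof -
  have "0 < sin x - x + x ^ 3 / 6"
    by (rule pos_if_deriv_pos[of x "\<lambda>z. sin z - z + z ^ 3 / 6" "\<lambda>z. cos z - (1 - z\<^sup>2 / 2)"])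
      (use assms cos_greater_quadratic in \<open>auto intro!: derivative_eq_intros\<close>)
  then show ?thesis by simp
qed

lemma cos_less_quartic:
  fixes x :: real
  assumes "0 < x"
  shows "cos x < 1 - x\<^sup>2 / 2 + x ^ 4 / 24"
proof -
  have "0 < 1 - x\<^sup>2 / 2 + x ^ 4 / 24 - cos x"
    by (rule pos_if_deriv_pos[of x "\<lambda>z. 1 - z\<^sup>2 / 2 + z ^ 4 / 24 - cos z"
          "\<lambda>z. sin z - (z - z ^ 3 / 6)"])
      (use assms sin_greater_cubic in \<open>auto intro!: derivative_eq_intros\<close>)
  then show ?thesis by simp
qed

lemma sinh_greater_cubic:
  fixes x :: real
  assumes "0 < x"
  shows "x + x ^ 3 / 6 < sinh x"
proof -
  have sinh: "0 < sinh y - y" if "0 < y" for y :: real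
    by (rule pos_if_deriv_pos[of y "\<lambda>z. sinh z - z" "\<lambda>z. cosh z - 1"])
      (use that cosh_real_strict_mono[of 0] in \<open>auto intro!: derivative_eq_intros\<close>)
  have cosh: "0 < cosh y - 1 - y\<^sup>2 / 2" if "0 < y" for y :: real
    by (rule pos_if_deriv_pos[of y "\<lambda>z. cosh z - 1 - z\<^sup>2 / 2" "\<lambda>z. sinh z - z"])
      (use that sinh in \<open>auto intro!: derivative_eq_intros\<close>)
  have "0 < sinh x - x - x ^ 3 / 6"
    by (rule pos_if_deriv_pos[of x "\<lambda>z. sinh z - z - z ^ 3 / 6" "\<lambda>z. cosh z - 1 - z\<^sup>2 / 2"])
      (use assms cosh in \<open>auto intro!: derivative_eq_intros\<close>)
  then show ?thesis by simp
qed

text \<open>Dividing by x sin x gives b < a. The facts \<open>h1\<close>, \<open>h0\<close> and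
  \<open>g1\<close> climb back from the fourth derivative, which is positive on (0, pi);
  \<open>h0\<close> is half the second derivative.\<close>

lemma sin_mult_sinh_less:
  fixes x :: real
  assumes "0 < x" "x < pi"
  shows "sin x * sinh x < x\<^sup>2"
proof -
  have h1: "0 < sin y * cosh y - cos y * sinh y" if "0 < y" "y < pi" for y :: real
    by (rule pos_if_deriv_pos[of y "\<lambda>z. sin z * cosh z - cos z * sinh z"
          "\<lambda>z. 2 * sin z * sinh z"])
      (use that in \<open>auto intro!: derivative_eq_intros mult_pos_pos sin_gt_zero
          simp: algebra_simps\<close>)
  have h0: "0 < 1 - cos y * cosh y" if "0 < y" "y < pi" for y :: real
    by (rule pos_if_deriv_pos[of y "\<lambda>z. 1 - cos z * cosh z"
          "\<lambda>z. sin z * cosh z - cos z * sinh z"])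
      (use that h1 in \<open>auto intro!: derivative_eq_intros simp: algebra_simps\<close>)
  have g1: "0 < 2 * y - cos y * sinh y - sin y * cosh y" if "0 < y" "y < pi" for y :: real
    by (rule pos_if_deriv_pos[of y "\<lambda>z. 2 * z - cos z * sinh z - sin z * cosh z"
          "\<lambda>z. 2 * (1 - cos z * cosh z)"])
      (use that h0 in \<open>auto intro!: derivative_eq_intros simp: algebra_simps\<close>)
  have "0 < x\<^sup>2 - sin x * sinh x"
    by (rule pos_if_deriv_pos[of x "\<lambda>z. z\<^sup>2 - sin z * sinh z"
          "\<lambda>z. 2 * z - cos z * sinh z - sin z * cosh z"])
      (use assms g1 in \<open>auto intro!: derivative_eq_intros simp: algebra_simps\<close>)
  then show ?thesis by simp
qed

text \<open>
  The quartic upper bound for \<open>cos x\<close> is negative when \<open>3 \<le> x\<^sup>2 \<le> 4\<close>.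
\<close>

lemma square_less_3:
  fixes x :: real
  assumes "0 < x" "x \<le> pi / 2"
  shows "x\<^sup>2 < 3"
proof (rule ccontr)
  assume "\<not> x\<^sup>2 < 3"
  moreover have "x \<le> 2"
    using assms(2) pi_half_less_two by linarith
  then have "x\<^sup>2 \<le> 2\<^sup>2"
    using assms(1) by (intro power_mono) auto
  ultimately have "(x\<^sup>2 - 3) * (x\<^sup>2 - 4) \<le> 0"
    by (intro mult_nonneg_nonpos) auto
  then have "x ^ 4 \<le> 7 * x\<^sup>2 - 12"
    by (simp add: algebra_simps eval_nat_numeral)
  \<comment> \<open>Eliminating x^4 from the quartic bound leaves cos x < 1/2 - 5 x^2 / 24 <=
    -1/8.\<close>
  then have "cos x < 0"
    using cos_less_quartic[OF assms(1)] \<open>\<not> x\<^sup>2 < 3\<close> by linarith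
  with cos_ge_zero[of x] assms show False by linarith
qed

text \<open>Dividing by x^2 sin x gives a < b^2. Cubic Taylor bounds for both functions suffice as
  long as x^2 < 3.\<close>

lemma sinh_square_mult_sin_greater:
  fixes x :: real
  assumes "0 < x" "x \<le> pi / 2"
  shows "x ^ 3 < (sinh x)\<^sup>2 * sin x"
proof -
  have "x\<^sup>2 < 3"
    using square_less_3[OF assms] .
  then have "0 < x ^ 5 * (3 - x\<^sup>2)"
    using assms(1) by simp
  \<comment> \<open>The right side exceeds x^3 by exactly x^5 (3 - x^2) / 18. Its first factor is
    the square of x + x^3 / 6 without the term x^6 / 36.\<close>
  then have "x ^ 3 < (x\<^sup>2 + x ^ 4 / 3) * (x - x ^ 3 / 6)"
    by (simp add: field_simps eval_nat_numeral)
  also have "\<dots> \<le> (sinh x)\<^sup>2 * sin x"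
  proof (rule mult_mono)
    have "(x + x ^ 3 / 6)\<^sup>2 = x\<^sup>2 + x ^ 4 / 3 + (x ^ 3 / 6)\<^sup>2"
      by (simp add: field_simps eval_nat_numeral)
    then have "x\<^sup>2 + x ^ 4 / 3 \<le> (x + x ^ 3 / 6)\<^sup>2"
      by simp
    also have "\<dots> \<le> (sinh x)\<^sup>2"
      using sinh_greater_cubic[OF assms(1)] assms(1) by (intro power_mono) auto
    finally show "x\<^sup>2 + x ^ 4 / 3 \<le> (sinh x)\<^sup>2" .
    show "x - x ^ 3 / 6 \<le> sin x"
      using sin_greater_cubic[OF assms(1)] by simp
    have "0 \<le> x * (6 - x\<^sup>2)"
      using assms(1) \<open>x\<^sup>2 < 3\<close> by simp
    then show "0 \<le> x - x ^ 3 / 6"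
      by (simp add: algebra_simps power2_eq_square power3_eq_cube)
  qed auto
  finally show ?thesis .
qed

text \<open>Replacing p^2 by the smaller q leaves q + 1/q, which is at least 2.\<close>

lemma sum_two_greater:
  fixes p q :: real
  assumes "0 < q" "q < p\<^sup>2"
  shows "2 < p\<^sup>2 + 1 / q"
proof -
  have "2 * q \<le> q * q + 1"
    using zero_le_power2[of "q - 1"] by (simp add: power2_eq_square algebra_simps)
  also have "\<dots> < q * p\<^sup>2 + 1"
    using assms by simp
  finally show ?thesis
    using assms(1) by (simp add: field_simps)
qed

lemma sum_three_greater:
  fixes p q :: real
  assumes "0 < p" "0 < q" "q < p\<^sup>2"
  shows "3 < 2 * p + 1 / q"
proof -
  \<comment> \<open>This product is 2 p^3 - 3 p^2 + 1; dividing by p^2 gives AM-GM for p, p and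
    1/p^2.\<close>
  have "0 \<le> (p - 1)\<^sup>2 * (2 * p + 1)"
    using assms(1) by simp
  then have "3 \<le> 2 * p + 1 / p\<^sup>2"
    using assms(1) by (simp add: field_simps power2_eq_square power3_eq_cube)
  also have "\<dots> < 2 * p + 1 / q"
    using assms by (simp add: frac_less2)
  finally show ?thesis .
qed

theorem theorem3:
  fixes x t :: real
  assumes "x \<in> {0<..pi / 2}" and "t > 0"
  shows "((x / sin x) powr (2 * t) + (x / sinh x) powr t
            > (sinh x / x) powr (2 * t) + (sin x / x) powr t
          \<and> (sinh x / x) powr (2 * t) + (sin x / x) powr t > 2)
       \<and> (2 * (x / sin x) powr t + (x / sinh x) powr t
            > 2 * (sinh x / x) powr t + (sin x / x) powr t
          \<and> 2 * (sinh x / x) powr t + (sin x / x) powr t > 3)"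
proof -
  from assms(1) have x: "0 < x" "x \<le> pi / 2" by auto
  then have "x < pi"
    using pi_gt_zero by linarith
  with x have sin: "0 < sin x" by (intro sin_gt_zero)
  have sinh: "0 < sinh x" using x by simp
  \<comment> \<open>With p = b^t and q = a^t the two chains read q^2 + 1/p > p^2 + 1/q > 2 and 2q +
    1/p > 2p + 1/q > 3. Both follow from p < q < p^2.\<close>
  define p where "p = (sinh x / x) powr t"
  define q where "q = (x / sin x) powr t"
  have pq: "0 < p" "0 < q"
    using x sin sinh by (simp_all add: p_def q_def)
  have "sinh x / x < x / sin x"
    using sin_mult_sinh_less[OF x(1) \<open>x < pi\<close>] x sin
    by (simp add: field_simps power2_eq_square)
  then have "p < q"
    using x sinh assms(2) unfolding p_def q_def by (intro powr_less_mono2) auto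
  have p2: "(sinh x / x) powr (2 * t) = p\<^sup>2" and q2: "(x / sin x) powr (2 * t) = q\<^sup>2"
    by (simp_all add: p_def q_def power2_eq_square flip: powr_add)
  have "x / sin x < (sinh x / x)\<^sup>2"
    using sinh_square_mult_sin_greater[OF x] x sin
    by (simp add: field_simps power2_eq_square power3_eq_cube)
  also have "\<dots> = (sinh x / x) powr 2"
    using x sinh by simp
  finally have "q < ((sinh x / x) powr 2) powr t"
    using x sin assms(2) unfolding q_def by (intro powr_less_mono2) auto
  then have "q < p\<^sup>2"
    by (simp add: powr_powr p2)
  have p_inv: "(x / sinh x) powr t = 1 / p" and q_inv: "(sin x / x) powr t = 1 / q"
    using x sin sinh by (simp_all add: p_def q_def powr_divide)
  have "p\<^sup>2 < q\<^sup>2"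
    using \<open>p < q\<close> pq by (intro power_strict_mono) auto
  moreover have "1 / q < 1 / p"
    using \<open>p < q\<close> pq by (simp add: frac_less2)
  ultimately show ?thesis
    using sum_two_greater[OF pq(2) \<open>q < p\<^sup>2\<close>] sum_three_greater[OF pq \<open>q < p\<^sup>2\<close>] \<open>p < q\<close>
    unfolding p2 q2 p_inv q_inv p_def[symmetric] q_def[symmetric] by linarith
qed

end
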